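(* For all integers $m>2$ and $n\geq 2$, the expansion ratio of the generalized pancake graph $P(m,n)$ satisfies \[ h(P(m,n))\leq \frac{2\pi\sqrt{2n(n+1)}}{m}. \] Thus, for every fixed $n\geq 2$, $h(P(m,n))\to 0$ as $m\to\infty$. As a consequence, for every fixed $n>2$, the $2n$-regular family $\{P(m,n)\}_{m>2}$ is not an expander family.
   Context: $S(m,n)=\mathbb{Z}_m\wr S_n=(\mathbb{Z}_m)^n\rtimes S_n$ is the group of colored permutations, where $S_n$ acts on $(\mathbb{Z}_m)^n$ by $(\sigma\cdot a)_j=a_{\sigma^{-1}(j)}$, so that $(a,\sigma)(b,\tau)=(a+\sigma\cdot b,\sigma\tau)$. For $1\le i\le n$, $r_i\in S_n$ is the permutation with $r_i(j)=i+1-j$ for $j\le i$ and $r_i(j)=j$ for $j>i$ (so $r_1=e$). For $\varepsilon\in\{+,-\}$, let $c_i^{\varepsilon}\in(\mathbb{Z}_m)^n$ be the vector whose first $i$ components are all $\varepsilon 1$ (i.e. $+1$ or $-1$) and whose other components are $0$, and let $r_i^{\varepsilon}=(c_i^{\varepsilon},r_i)\in S(m,n)$. The set of generalized prefix reversals is $R(m,n)=\{r_i^{\varepsilon}:1\le i\le n,\ \varepsilon\in\{+,-\}\}$; it is closed under inverses, and for $m\ge3$ it has $2n$ elements. The generalized pancake graph $P(m,n)$ is the (undirected) Cayley graph of $S(m,n)$ with respect to $R(m,n)$: its vertex set is $S(m,n)$ and its edges join $x$ to $s x$ for $s\in R(m,n)$. For $m>2$ it is $2n$-regular. The expansion ratio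 of a finite $d$-regular graph $\mathcal G=(V,E)$ is \[ h(\mathcal G)=\min_{\emptyset\neq U\subseteq V,\ |U|\le |V|/2}\frac{|\partial U|}{|U|}, \] where $\partial U$ is the set of edges having one endpoint in $U$ and the other in $V\setminus U$. A family $\{\mathcal G_j\}_{j\ge1}$ of finite $d$-regular graphs $\mathcal G_j=(V_j,E_j)$ ($d$ fixed) with $|V_j|\to\infty$ is an expander family if there exists $\epsilon>0$ such that $h(\mathcal G_j)\ge\epsilon$ for every $j$. *)

theory Defs
  imports Complex_Main "HOL-Algebra.Sym_Groups" "HOL-Algebra.Product_Groups"
begin

section \<open>Colored permutations\<close>

definition semidirect_product ::
    "('a, 'c) monoid_scheme \<Rightarrow> ('b, 'd) monoid_scheme \<Rightarrow> ('b \<Rightarrow> 'a \<Rightarrow> 'a) \<Rightarrow> ('a \<times> 'b) monoid" where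
  "semidirect_product N H \<phi> =
     \<lparr>carrier = carrier N \<times> carrier H,
      monoid.mult = (\<lambda>(a, s) (b, t). (a \<otimes>\<^bsub>N\<^esub> \<phi> s b, s \<otimes>\<^bsub>H\<^esub> t)),
      one = (\<one>\<^bsub>N\<^esub>, \<one>\<^bsub>H\<^esub>)\<rparr>"

definition color_vectors :: "nat \<Rightarrow> nat \<Rightarrow> (nat \<Rightarrow> int) monoid" where
  "color_vectors m n = product_group {1..n} (\<lambda>_. integer_mod_group m)"

definition perm_action :: "nat \<Rightarrow> (nat \<Rightarrow> nat) \<Rightarrow> (nat \<Rightarrow> int) \<Rightarrow> (nat \<Rightarrow> int)" where
  "perm_action n s a = (\<lambda>j\<in>{1..n}. a ((inv\<^bsub>sym_group n\<^esub> s) j))"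

definition colored_perm_group :: "nat \<Rightarrow> nat \<Rightarrow> ((nat \<Rightarrow> int) \<times> (nat \<Rightarrow> nat)) monoid" where
  "colored_perm_group m n = semidirect_product (color_vectors m n) (sym_group n) (perm_action n)"

definition prefix_reversal :: "nat \<Rightarrow> nat \<Rightarrow> nat" where
  "prefix_reversal i = (\<lambda>j. if 1 \<le> j \<and> j \<le> i then i + 1 - j else j)"

text \<open>Residues are represented in \<open>{0..<m}\<close>, hence the reduction of the sign modulo \<open>m\<close>.\<close>

definition prefix_color :: "nat \<Rightarrow> nat \<Rightarrow> nat \<Rightarrow> int \<Rightarrow> (nat \<Rightarrow> int)" where
  "prefix_color m n i \<epsilon> = (\<lambda>j\<in>{1..n}. if j \<le> i then \<epsilon> mod int m else 0)"

definition gen_prefix_reversals :: "nat \<Rightarrow> nat \<Rightarrow> ((nat \<Rightarrow> int) \<times> (nat \<Rightarrow> nat)) set" where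
  "gen_prefix_reversals m n =
     {(prefix_color m n i \<epsilon>, prefix_reversal i) | i \<epsilon>. i \<in> {1..n} \<and> \<epsilon> \<in> {1, -1}}"


section \<open>Graphs and expansion\<close>

text \<open>A graph is a pair of a vertex set and a set of edges, an edge being an unordered pair
  of distinct vertices.\<close>

type_synonym 'v graph = "'v set \<times> 'v set set"

abbreviation verts :: "'v graph \<Rightarrow> 'v set" where "verts G \<equiv> fst G"
abbreviation edges :: "'v graph \<Rightarrow> 'v set set" where "edges G \<equiv> snd G"

definition finite_regular_graph :: "nat \<Rightarrow> 'v graph \<Rightarrow> bool" where
  "finite_regular_graph d G \<longleftrightarrow>
     finite (verts G) \<and>
     (\<forall>e\<in>edges G. e \<subseteq> verts G \<and> card e = 2) \<and>
     (\<forall>v\<in>verts G. card {e \<in> edges G. v \<in> e} = d)"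

definition edge_boundary :: "'v graph \<Rightarrow> 'v set \<Rightarrow> 'v set set" where
  "edge_boundary G U = {e \<in> edges G. \<exists>u\<in>U. \<exists>v\<in>verts G - U. e = {u, v}}"

definition expansion_ratio :: "'v graph \<Rightarrow> real" where
  "expansion_ratio G =
     Min {real (card (edge_boundary G U)) / real (card U) | U.
            U \<noteq> {} \<and> U \<subseteq> verts G \<and> real (card U) \<le> real (card (verts G)) / 2}"

text \<open>Families are indexed by \<open>j \<ge> 1\<close>; the value at \<open>0\<close> is ignored.\<close>

definition regular_graph_family :: "nat \<Rightarrow> (nat \<Rightarrow> 'v graph) \<Rightarrow> bool" where
  "regular_graph_family d G \<longleftrightarrow>
     (\<forall>j\<ge>1. finite_regular_graph d (G j)) \<and>
     filterlim (\<lambda>j. card (verts (G j))) at_top sequentially"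

definition expander_family :: "nat \<Rightarrow> (nat \<Rightarrow> 'v graph) \<Rightarrow> bool" where
  "expander_family d G \<longleftrightarrow>
     regular_graph_family d G \<and> (\<exists>\<epsilon>>0. \<forall>j\<ge>1. expansion_ratio (G j) \<ge> \<epsilon>)"

text \<open>Undirected only for \<open>S\<close> closed under inverses; an identity element in \<open>S\<close> would give
  one-element edges. Neither issue arises for \<open>gen_prefix_reversals m n\<close> with \<open>m > 2\<close>.\<close>

definition cayley_graph :: "('a, 'c) monoid_scheme \<Rightarrow> 'a set \<Rightarrow> 'a graph" where
  "cayley_graph \<Gamma> S = (carrier \<Gamma>, {{x, s \<otimes>\<^bsub>\<Gamma>\<^esub> x} | x s. x \<in> carrier \<Gamma> \<and> s \<in> S})"

definition pancake_graph :: "nat \<Rightarrow> nat \<Rightarrow> ((nat \<Rightarrow> int) \<times> (nat \<Rightarrow> nat)) graph" where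
  "pancake_graph m n = cayley_graph (colored_perm_group m n) (gen_prefix_reversals m n)"

end

theory Submission
  imports Defs
begin

text \<open>A single symbol already fails to mix. In a colored permutation \<open>(a, s)\<close>, follow the symbol
  \<open>1\<close>, which sits at position \<open>s 1\<close> and carries the color \<open>a (s 1)\<close>. Multiplying by
  \<open>r\<^sub>i\<^sup>\<epsilon>\<close> changes this color by \<open>\<epsilon>\<close> when the position is at most \<open>i\<close> and not at all otherwise,
  so the color performs a lazy walk on a cycle of length \<open>m\<close>. Let \<open>U\<close> consist of the
  vertices whose followed color lies in \<open>{0..<L}\<close> with \<open>L = m div 2\<close>. An edge labelled by \<open>i\<close> and \<open>\<epsilon>\<close>
  leaves \<open>U\<close> only from one extreme color (\<open>L - 1\<close> for \<open>\<epsilon> = 1\<close>, and \<open>0\<close> for \<open>\<epsilon> = -1\<close>) and only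
  from positions \<open>p \<le> i\<close> (\<open>flip_leaving\<close>).

  All pairs of a position and a color are attained by the same number \<open>N\<close> of vertices (\<open>card_fiber\<close>).
  Hence \<open>U\<close> has \<open>n L N\<close> elements, at most half of all \<open>n m N\<close> vertices, while its
  boundary has at most \<open>2 (1 + 2 + \<dots> + n) N = n (n + 1) N\<close> edges. This gives the ratio
  \<open>(n + 1) / (m div 2)\<close>, at most \<open>3 (n + 1) / m\<close> for \<open>m > 2\<close>, and so sharper than the claimed
  bound, as \<open>n + 1 \<le> sqrt (2 n (n + 1))\<close> and \<open>3 \<le> 2 \<pi>\<close>. This explicit cut takes the place of
  an estimate of the spectral gap.\<close>

section \<open>The pancake graph in coordinates\<close>

text \<open>Left multiplication by \<open>r\<^sub>i\<^sup>\<epsilon>\<close>, extended to arbitrary integers \<open>\<epsilon>\<close> so that the inverse is simply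
  the flip with \<open>-\<epsilon>\<close>. Since a prefix reversal is an involution, its action on color vectors
  needs no inverse permutation.\<close>

definition flip :: "nat \<Rightarrow> nat \<Rightarrow> nat \<Rightarrow> int \<Rightarrow> (nat \<Rightarrow> int) \<times> (nat \<Rightarrow> nat) \<Rightarrow> (nat \<Rightarrow> int) \<times> (nat \<Rightarrow> nat)"
  where "flip m n i \<epsilon> x =
    (\<lambda>j\<in>{1..n}. ((if j \<le> i then \<epsilon> else 0) + fst x (prefix_reversal i j)) mod int m,
     prefix_reversal i \<circ> snd x)"

lemma prefix_reversal_invol [simp]: "prefix_reversal i (prefix_reversal i j) = j"
  by (auto simp: prefix_reversal_def)

lemma prefix_reversal_le_iff [simp]: "prefix_reversal i j \<le> i \<longleftrightarrow> j \<le> i"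
  by (auto simp: prefix_reversal_def)

lemma prefix_reversal_in: "i \<in> {1..n} \<Longrightarrow> j \<in> {1..n} \<Longrightarrow> prefix_reversal i j \<in> {1..n}"
  by (auto simp: prefix_reversal_def)

lemma prefix_reversal_permutes: "i \<in> {1..n} \<Longrightarrow> prefix_reversal i permutes {1..n}"
  by (intro bij_imp_permutes bij_betwI[where g = "prefix_reversal i"])
     (auto simp: prefix_reversal_def)

lemma inv_prefix_reversal: "inv' (prefix_reversal i) = prefix_reversal i"
  by (rule inv_equality) auto

lemma carrier_colored_perm_group:
  assumes "m > 0"
  shows "carrier (colored_perm_group m n) = ({1..n} \<rightarrow>\<^sub>E {0..<int m}) \<times> {s. s permutes {1..n}}"
  using assms
  by (simp add: colored_perm_group_def semidirect_product_def color_vectors_def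
      carrier_integer_mod_group sym_group_def)

lemma prefix_reversal_mult:
  assumes "i \<in> {1..n}"
  shows "(prefix_color m n i \<epsilon>, prefix_reversal i) \<otimes>\<^bsub>colored_perm_group m n\<^esub> x = flip m n i \<epsilon> x"
proof -
  have "inv\<^bsub>sym_group n\<^esub> (prefix_reversal i) = prefix_reversal i"
    using prefix_reversal_permutes[OF assms]
    by (simp add: sym_group_carrier inv_prefix_reversal)
  then show ?thesis
    by (cases x) (auto simp: flip_def colored_perm_group_def semidirect_product_def color_vectors_def
      perm_action_def prefix_color_def sym_group_def mod_simps fun_eq_iff)
qed

lemma verts_pancake_graph:
  "m > 0 \<Longrightarrow> verts (pancake_graph m n) = ({1..n} \<rightarrow>\<^sub>E {0..<int m}) \<times> {s. s permutes {1..n}}"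
  by (simp add: pancake_graph_def cayley_graph_def carrier_colored_perm_group)

lemma edges_pancake_graph:
  "edges (pancake_graph m n) =
    {{x, flip m n i \<epsilon> x} | x i \<epsilon>. x \<in> verts (pancake_graph m n) \<and> i \<in> {1..n} \<and> \<epsilon> \<in> {1, -1}}"
  unfolding pancake_graph_def cayley_graph_def gen_prefix_reversals_def fst_conv snd_conv mem_Collect_eq
  by (intro Collect_cong) (metis prefix_reversal_mult)

lemma flip_in_verts:
  assumes "m > 0" "i \<in> {1..n}" "x \<in> verts (pancake_graph m n)"
  shows "flip m n i \<epsilon> x \<in> verts (pancake_graph m n)"
  using assms prefix_reversal_permutes[OF assms(2)]
  by (auto simp: verts_pancake_graph flip_def intro: permutes_compose)

lemma flip_flip:
  assumes "m > 0" "i \<in> {1..n}" "x \<in> verts (pancake_graph m n)"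
  shows "flip m n i (-\<epsilon>) (flip m n i \<epsilon> x) = x"
proof -
  obtain a s where x: "x = (a, s)" by force
  have a: "a \<in> {1..n} \<rightarrow>\<^sub>E {0..<int m}" using assms by (simp add: x verts_pancake_graph)
  have "fst (flip m n i (-\<epsilon>) (flip m n i \<epsilon> x)) j = a j" for j
  proof (cases "j \<in> {1..n}")
    case True
    then have "a j mod int m = a j" using PiE_mem[OF a True] by simp
    then show ?thesis using True prefix_reversal_in[OF assms(2) True]
      by (simp add: x flip_def mod_simps)
  next
    case False
    then show ?thesis using PiE_arb[OF a False] by (simp add: flip_def del: atLeastAtMost_iff)
  qed
  then show ?thesis by (auto simp: x prod_eq_iff flip_def fun_eq_iff)
qed

section \<open>Regularity\<close>

text \<open>The permutation part determines \<open>i\<close>, since \<open>r\<^sub>i\<close> maps \<open>1\<close> to \<open>i\<close>; the color at position \<open>1\<close>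
  then determines \<open>\<epsilon>\<close> modulo \<open>m\<close>, and \<open>1\<close> and \<open>-1\<close> are distinct modulo \<open>m\<close> because \<open>m > 2\<close>.\<close>

lemma flip_inj:
  assumes m: "m > 2" and ij: "i \<in> {1..n}" "j \<in> {1..n}" and eps: "\<epsilon> \<in> {1, -1}" "\<delta> \<in> {1, -1}"
    and x: "x \<in> verts (pancake_graph m n)" and eq: "flip m n i \<epsilon> x = flip m n j \<delta> x"
  shows "i = j \<and> \<epsilon> = \<delta>"
proof -
  have "snd x permutes {1..n}" using x m by (auto simp: verts_pancake_graph)
  then have "surj (snd x)" by (rule permutes_surj)
  then obtain k where k: "snd x k = 1" by (metis surjD)
  have "prefix_reversal i (snd x k) = prefix_reversal j (snd x k)"
    using eq by (auto simp: flip_def fun_eq_iff)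
  then have 1: "i = j" using ij by (simp add: k prefix_reversal_def)
  have "fst (flip m n i \<epsilon> x) 1 = fst (flip m n j \<delta> x) 1" using eq by simp
  then have "(\<epsilon> + fst x (prefix_reversal i 1)) mod int m = (\<delta> + fst x (prefix_reversal i 1)) mod int m"
    using ij 1 by (simp add: flip_def)
  then have "int m dvd \<epsilon> - \<delta>" by (simp add: mod_eq_dvd_iff)
  then have "\<epsilon> = \<delta>" using eps m zdvd_not_zless[of 2 "int m"] by auto
  with 1 show ?thesis by simp
qed

text \<open>A flip that fixes \<open>x\<close> would agree at \<open>x\<close> with its inverse, which has the opposite sign.\<close>

lemma flip_neq:
  assumes m: "m > 2" and i: "i \<in> {1..n}" and eps: "\<epsilon> \<in> {1, -1}"
    and x: "x \<in> verts (pancake_graph m n)"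
  shows "flip m n i \<epsilon> x \<noteq> x"
proof
  assume eq: "flip m n i \<epsilon> x = x"
  then have "flip m n i (-\<epsilon>) x = flip m n i \<epsilon> x" using flip_flip[of m i n x \<epsilon>] m i x by simp
  then show False using flip_inj[OF m i i _ eps x] eps by force
qed

text \<open>An edge generated at another vertex \<open>x\<close> and meeting \<open>v\<close> is also generated at \<open>v\<close>, by the
  inverse flip. So the edges at \<open>v\<close> correspond to the \<open>2n\<close> flips.\<close>

lemma finite_regular_pancake_graph:
  assumes m: "m > 2"
  shows "finite_regular_graph (2 * n) (pancake_graph m n)"
  unfolding finite_regular_graph_def
proof (intro conjI ballI)
  let ?V = "verts (pancake_graph m n)"
  show "finite ?V"
    using m by (simp add: verts_pancake_graph finite_PiE finite_permutations)
  fix e assume "e \<in> edges (pancake_graph m n)"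
  then obtain x i \<epsilon> where e: "x \<in> ?V" "i \<in> {1..n}" "\<epsilon> \<in> {1, -1}" "e = {x, flip m n i \<epsilon> x}"
    unfolding edges_pancake_graph by blast
  show "e \<subseteq> ?V" using flip_in_verts[of m i n x \<epsilon>] e m by simp
  show "card e = 2" using flip_neq[OF m e(2,3,1)] e(4) by auto
next
  let ?V = "verts (pancake_graph m n)"
  fix v assume v: "v \<in> ?V"
  let ?A = "{1..n} \<times> {1, -1::int}"
  let ?g = "\<lambda>(i, \<epsilon>). {v, flip m n i \<epsilon> v}"
  have "{e \<in> edges (pancake_graph m n). v \<in> e} = ?g ` ?A"
  proof (intro equalityI subsetI)
    fix e assume "e \<in> {e \<in> edges (pancake_graph m n). v \<in> e}"
    then obtain x i \<epsilon> where e: "x \<in> ?V" "i \<in> {1..n}" "\<epsilon> \<in> {1, -1}" "e = {x, flip m n i \<epsilon> x}" "v \<in> e"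
      unfolding edges_pancake_graph by blast
    show "e \<in> ?g ` ?A"
    proof (cases "v = x")
      case True
      then show ?thesis using e by auto
    next
      case False
      then have "v = flip m n i \<epsilon> x" using e by simp
      then have "e = ?g (i, -\<epsilon>)" using flip_flip[of m i n x \<epsilon>] m e by auto
      moreover have "(i, -\<epsilon>) \<in> ?A" using e by auto
      ultimately show ?thesis by blast
    qed
  next
    fix e assume "e \<in> ?g ` ?A"
    then obtain i \<epsilon> where "i \<in> {1..n}" "\<epsilon> \<in> {1, -1}" "e = {v, flip m n i \<epsilon> v}" by blast
    then show "e \<in> {e \<in> edges (pancake_graph m n). v \<in> e}"
      unfolding edges_pancake_graph using v by blast
  qed
  moreover have "inj_on ?g ?A"
  proof (rule inj_onI, clarify)
    fix i \<epsilon> j \<delta>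
    assume a: "i \<in> {1..n}" "j \<in> {1..n}" "\<epsilon> \<in> {1, -1::int}" "\<delta> \<in> {1, -1::int}"
      and "{v, flip m n i \<epsilon> v} = {v, flip m n j \<delta> v}"
    then have "flip m n i \<epsilon> v = flip m n j \<delta> v" by (auto simp: doubleton_eq_iff)
    then show "i = j \<and> \<epsilon> = \<delta>" using flip_inj[OF m a v] by simp
  qed
  ultimately show "card {e \<in> edges (pancake_graph m n). v \<in> e} = 2 * n"
    by (simp add: card_image)
qed

section \<open>Following one symbol\<close>

text \<open>Composing with a transposition shows that the count does not depend on \<open>b\<close>.\<close>

lemma card_permutes_with_value:
  assumes "finite A" "a \<in> A" "b \<in> A"
  shows "card {s. s permutes A \<and> s a = b} = fact (card A - 1)"
proof -
  let ?S = "\<lambda>b. {s. s permutes A \<and> s a = b}"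
  have fin: "finite (?S c)" for c
    by (rule finite_subset[OF _ finite_permutations[OF assms(1)]]) auto
  have le: "card (?S c) \<le> card (?S d)" if "c \<in> A" "d \<in> A" for c d
  proof (rule card_inj_on_le[OF _ _ fin])
    show "inj_on (\<lambda>s. transpose c d \<circ> s) (?S c)"
      by (rule inj_onI) (metis comp_assoc id_comp transpose_comp_involutory)
    show "(\<lambda>s. transpose c d \<circ> s) ` ?S c \<subseteq> ?S d"
      using that by (auto intro: permutes_compose permutes_swap_id)
  qed
  have eq: "card (?S c) = card (?S b)" if "c \<in> A" for c
    using le[OF that assms(3)] le[OF assms(3) that] by simp
  have "{s. s permutes A} = (\<Union>c\<in>A. ?S c)"
    using assms(2) by (auto simp: permutes_in_image)
  moreover have "card (\<Union>c\<in>A. ?S c) = (\<Sum>c\<in>A. card (?S c))"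
    using assms(1) fin by (intro card_UN_disjoint) auto
  ultimately have "fact (card A) = card A * card (?S b)"
    using eq card_permutations[OF refl assms(1)] by simp
  moreover have "card A > 0" using assms card_gt_0_iff by blast
  ultimately show ?thesis by (simp add: fact_reduce[of "card A"])
qed

definition fiber :: "nat \<Rightarrow> nat \<Rightarrow> nat \<Rightarrow> int \<Rightarrow> ((nat \<Rightarrow> int) \<times> (nat \<Rightarrow> nat)) set" where
  "fiber m n p c = {(a, s) \<in> verts (pancake_graph m n). s 1 = p \<and> a p = c}"

lemma card_fiber:
  assumes "m > 0" "p \<in> {1..n}" "c \<in> {0..<int m}"
  shows "card (fiber m n p c) = m ^ (n - 1) * fact (n - 1)"
proof -
  let ?A = "PiE {1..n} (\<lambda>j. if j = p then {c} else {0..<int m})"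
  have "fiber m n p c = ?A \<times> {s. s permutes {1..n} \<and> s 1 = p}"
    using assms by (auto simp: fiber_def verts_pancake_graph PiE_iff extensional_def split: if_splits)
  moreover have "card ?A = m ^ (n - 1)"
  proof -
    have "card ?A = (\<Prod>j\<in>{1..n}. if j = p then 1 else m)"
      by (subst card_PiE) (auto intro!: prod.cong)
    also have "\<dots> = (\<Prod>j\<in>{1..n} - {p}. m)"
      using assms(2) by (subst prod.remove[of _ p]) (auto intro!: prod.cong)
    also have "\<dots> = m ^ (n - 1)" using assms(2) by simp
    finally show ?thesis .
  qed
  ultimately show ?thesis
    using card_permutes_with_value[of "{1..n}" 1 p] assms(2) by (simp add: card_cartesian_product)
qed

lemma finite_fiber: "m > 0 \<Longrightarrow> finite (fiber m n p c)"
  by (rule finite_subset[of _ "verts (pancake_graph m n)"])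
     (auto simp: fiber_def verts_pancake_graph finite_PiE finite_permutations)

text \<open>The cut used for the bound is the case \<open>L = m div 2\<close>; the case \<open>L = m\<close> counts all vertices.\<close>

definition low_color :: "nat \<Rightarrow> nat \<Rightarrow> nat \<Rightarrow> ((nat \<Rightarrow> int) \<times> (nat \<Rightarrow> nat)) set" where
  "low_color m n L = (\<Union>p\<in>{1..n}. \<Union>c\<in>{0..<int L}. fiber m n p c)"

lemma card_low_color:
  assumes "m > 0" "L \<le> m"
  shows "card (low_color m n L) = n * (L * (m ^ (n - 1) * fact (n - 1)))"
proof -
  have "card (low_color m n L) = (\<Sum>p\<in>{1..n}. card (\<Union>c\<in>{0..<int L}. fiber m n p c))"
    unfolding low_color_def using assms
    by (intro card_UN_disjoint) (auto simp: finite_fiber, auto simp: fiber_def)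
  also have "\<dots> = (\<Sum>p\<in>{1..n}. \<Sum>c\<in>{0..<int L}. card (fiber m n p c))"
    using assms by (intro sum.cong refl card_UN_disjoint) (auto simp: finite_fiber, auto simp: fiber_def)
  also have "\<dots> = (\<Sum>p\<in>{1..n}. \<Sum>c\<in>{0..<int L}. m ^ (n - 1) * fact (n - 1))"
    using assms by (intro sum.cong refl card_fiber) auto
  finally show ?thesis by simp
qed

lemma verts_eq_low_color:
  assumes "m > 0" "n > 0"
  shows "verts (pancake_graph m n) = low_color m n m"
proof -
  have "s 1 \<in> {1..n}" if "s permutes {1..n}" for s
    using permutes_in_image[OF that, of 1] assms by simp
  then show ?thesis
    using assms unfolding low_color_def
    by (fastforce simp: fiber_def verts_pancake_graph dest: PiE_mem)
qed

text \<open>The followed color moves by at most one step modulo \<open>m\<close>, so it can leave the interval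
  \<open>{0..<L}\<close> only across one of its two ends, and it moves only when its position lies in the
  reversed prefix.\<close>

lemma flip_leaving:
  assumes L: "0 < L" "L \<le> m" and i: "i \<in> {1..n}" and eps: "\<epsilon> \<in> {1, -1}"
    and u: "u \<in> low_color m n L" "flip m n i \<epsilon> u \<notin> low_color m n L"
  shows "\<exists>p\<in>{1..i}. u \<in> fiber m n p (if \<epsilon> = 1 then int L - 1 else 0)"
proof -
  obtain p c where pc: "p \<in> {1..n}" "c \<in> {0..<int L}" and uf: "u \<in> fiber m n p c"
    using u(1) by (auto simp: low_color_def)
  obtain a s where u': "u = (a, s)" by force
  define q where "q = prefix_reversal i p"
  define d where "d = ((if p \<le> i then \<epsilon> else 0) + c) mod int m"
  have q: "q \<in> {1..n}" unfolding q_def by (rule prefix_reversal_in[OF i pc(1)])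
  have V: "flip m n i \<epsilon> u \<in> verts (pancake_graph m n)"
    using uf i L by (intro flip_in_verts) (auto simp: fiber_def)
  then have "flip m n i \<epsilon> u \<in> fiber m n q d"
    using uf q by (auto simp: u' fiber_def flip_def q_def d_def)
  then have "d \<notin> {0..<int L}" using u(2) q by (auto simp: low_color_def)
  then have "d \<ge> int L" using L by (simp add: d_def)
  moreover have "c = 0 \<or> (c - 1) mod int m \<le> c - 1"
    using pc(2) zmod_le_nonneg_dividend[of "c - 1" "int m"] by force
  ultimately have "p \<le> i \<and> c = (if \<epsilon> = 1 then int L - 1 else 0)"
    using pc(2) eps L zmod_le_nonneg_dividend[of "1 + c" "int m"]
    by (auto simp: d_def split: if_splits)
  then show ?thesis using uf pc(1) by auto
qed

text \<open>A boundary edge may have been generated at its outer endpoint; the inverse flip then generates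
  it at the inner one. It is therefore enough to count the flips leaving the set.\<close>

lemma card_boundary_low_color:
  assumes L: "0 < L" "L \<le> m"
  shows "card (edge_boundary (pancake_graph m n) (low_color m n L))
    \<le> n * (n + 1) * (m ^ (n - 1) * fact (n - 1))"
proof -
  let ?N = "m ^ (n - 1) * fact (n - 1) :: nat"
  let ?G = "pancake_graph m n" and ?U = "low_color m n L"
  let ?F = "\<lambda>i \<epsilon> p. (\<lambda>u. {u, flip m n i \<epsilon> u}) ` fiber m n p (if \<epsilon> = 1 then int L - 1 else 0)"
  let ?T = "\<Union>i\<in>{1..n}. \<Union>\<epsilon>\<in>{1, -1}. \<Union>p\<in>{1..i}. ?F i \<epsilon> p"
  have m: "m > 0" using L by simp
  have "edge_boundary ?G ?U \<subseteq> ?T"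
  proof
    fix e assume "e \<in> edge_boundary ?G ?U"
    then obtain u v x i \<epsilon> where e: "u \<in> ?U" "v \<notin> ?U" "e = {u, v}"
      "x \<in> verts ?G" "i \<in> {1..n}" "\<epsilon> \<in> {1, -1}" "e = {x, flip m n i \<epsilon> x}"
      unfolding edge_boundary_def edges_pancake_graph by blast
    have "\<exists>\<delta>\<in>{1, -1}. v = flip m n i \<delta> u"
    proof (cases "u = x")
      case True
      then show ?thesis using e by (auto simp: doubleton_eq_iff)
    next
      case False
      then have "u = flip m n i \<epsilon> x" "v = x" using e by (auto simp: doubleton_eq_iff)
      then have "v = flip m n i (-\<epsilon>) u" using flip_flip[OF m e(5,4)] by simp
      then show ?thesis using e(6) by auto
    qed
    then obtain \<delta> where \<delta>: "\<delta> \<in> {1, -1}" "v = flip m n i \<delta> u" by blast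
    then obtain p where "p \<in> {1..i}" "u \<in> fiber m n p (if \<delta> = 1 then int L - 1 else 0)"
      using flip_leaving[OF L e(5) \<delta>(1) e(1)] e(2) by blast
    then have "e \<in> ?F i \<delta> p" using e(3) \<delta>(2) by (intro image_eqI) auto
    then show "e \<in> ?T" by (intro UN_I[OF e(5)] UN_I[OF \<delta>(1)] UN_I[OF \<open>p \<in> {1..i}\<close>])
  qed
  then have "card (edge_boundary ?G ?U) \<le> card ?T"
    by (intro card_mono finite_UN_I finite_imageI finite_fiber m) simp_all
  also have "\<dots> \<le> (\<Sum>i\<in>{1..n}. \<Sum>\<epsilon>\<in>{1, -1}. \<Sum>p\<in>{1..i}. card (?F i \<epsilon> p))"
    by (intro order_trans[OF card_UN_le] sum_mono) auto
  also have "\<dots> \<le> (\<Sum>i\<in>{1..n}. \<Sum>\<epsilon>\<in>{1, -1::int}. \<Sum>p\<in>{1..i}. ?N)"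
  proof (intro sum_mono)
    fix i p and \<epsilon> :: int assume "i \<in> {1..n}" "p \<in> {1..i}"
    have "card (?F i \<epsilon> p) \<le> card (fiber m n p (if \<epsilon> = 1 then int L - 1 else 0))"
      by (rule card_image_le[OF finite_fiber[OF m]])
    also have "\<dots> = ?N"
      using L \<open>i \<in> {1..n}\<close> \<open>p \<in> {1..i}\<close> by (intro card_fiber) auto
    finally show "card (?F i \<epsilon> p) \<le> ?N" .
  qed
  also have "\<dots> = (\<Sum>i\<in>{1..n}. 2 * i * ?N)"
    by (intro sum.cong refl) simp
  also have "\<dots> = 2 * (\<Sum>i\<in>{1..n}. i) * ?N"
    by (simp only: sum_distrib_left sum_distrib_right)
  also have "2 * (\<Sum>i\<in>{1..n}. i) = n * (n + 1)"
    using double_gauss_sum_from_Suc_0[of n, where 'a = nat] by simp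
  finally show ?thesis .
qed

section \<open>The expansion ratio\<close>

lemma finite_expansion_ratios:
  assumes "finite (verts G)"
  shows "finite {real (card (edge_boundary G U)) / real (card U) | U.
            U \<noteq> {} \<and> U \<subseteq> verts G \<and> real (card U) \<le> real (card (verts G)) / 2}"
  by (rule finite_subset[of _ "(\<lambda>U. real (card (edge_boundary G U)) / real (card U)) ` Pow (verts G)"])
     (use assms in auto)

lemma expansion_ratio_pancake_graph:
  assumes m: "m \<ge> 2" and n: "n > 0"
  shows "expansion_ratio (pancake_graph m n) \<le> real (n + 1) / real (m div 2)"
    and "0 \<le> expansion_ratio (pancake_graph m n)"
proof -
  let ?G = "pancake_graph m n" and ?N = "m ^ (n - 1) * fact (n - 1) :: nat"
  let ?U = "low_color m n (m div 2)"
  let ?R = "{real (card (edge_boundary ?G U)) / real (card U) | U.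
            U \<noteq> {} \<and> U \<subseteq> verts ?G \<and> real (card U) \<le> real (card (verts ?G)) / 2}"
  have m0: "m > 0" and L: "0 < m div 2" "m div 2 \<le> m" using m by auto
  have fin: "finite ?R"
    using m0 by (intro finite_expansion_ratios) (simp add: verts_pancake_graph finite_PiE finite_permutations)
  have cU: "card ?U = n * (m div 2 * ?N)" by (rule card_low_color[OF m0 L(2)])
  have cV: "card (verts ?G) = n * (m * ?N)"
    using card_low_color[OF m0, of m n] by (simp add: verts_eq_low_color[OF m0 n])
  have N: "?N > 0" using m0 by simp
  have "?U \<noteq> {}" using cU n L(1) N by force
  moreover have "?U \<subseteq> verts ?G" by (auto simp: low_color_def fiber_def)
  moreover have "real (card ?U) \<le> real (card (verts ?G)) / 2"
  proof -
    have "2 * card ?U = (2 * (m div 2)) * (n * ?N)" by (simp add: cU)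
    also have "\<dots> \<le> m * (n * ?N)" by (rule mult_right_mono) auto
    also have "\<dots> = card (verts ?G)" by (simp add: cV)
    finally have "real (2 * card ?U) \<le> real (card (verts ?G))" by (rule of_nat_mono)
    then show ?thesis by simp
  qed
  ultimately have mem: "real (card (edge_boundary ?G ?U)) / real (card ?U) \<in> ?R" by blast
  have "expansion_ratio ?G \<le> real (card (edge_boundary ?G ?U)) / real (card ?U)"
    unfolding expansion_ratio_def by (rule Min_le[OF fin mem])
  also have "\<dots> \<le> real (n * (n + 1) * ?N) / real (n * (m div 2 * ?N))"
    unfolding cU by (intro divide_right_mono of_nat_mono card_boundary_low_color L) auto
  also have "\<dots> = real (n + 1) / real (m div 2)"
  proof -
    have "real ?N \<noteq> 0" "real n \<noteq> 0" using N n by linarith+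
    moreover have "x * y * z / (x * (w * z)) = y / w" if "z \<noteq> 0" "x \<noteq> 0" for x y z w :: real
      using that by simp
    ultimately show ?thesis by (simp only: of_nat_mult)
  qed
  finally show "expansion_ratio ?G \<le> real (n + 1) / real (m div 2)" .
  have "expansion_ratio ?G \<in> ?R"
    unfolding expansion_ratio_def using mem by (intro Min_in fin) blast
  then show "0 \<le> expansion_ratio ?G" by auto
qed

lemma expansion_ratio_le:
  assumes m: "m > 2" and n: "n > 0"
  shows "expansion_ratio (pancake_graph m n) \<le> 2 * pi * sqrt (2 * real n * (real n + 1)) / real m"
proof -
  have "real (m div 2) \<ge> real m / 3"
  proof -
    have "3 * (m div 2) \<ge> m" using m by presburger
    then have "real m \<le> real (3 * (m div 2))" by (rule of_nat_mono)
    then show ?thesis by simp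
  qed
  then have "real (n + 1) / real (m div 2) \<le> real (n + 1) / (real m / 3)"
    using m by (intro divide_left_mono) auto
  also have "\<dots> = 3 * (real n + 1) / real m" by simp
  also have "\<dots> \<le> 2 * pi * sqrt (2 * real n * (real n + 1)) / real m"
  proof (rule divide_right_mono)
    have "real n + 1 \<le> sqrt (2 * real n * (real n + 1))"
      using n by (intro real_le_rsqrt) (simp add: power2_eq_square mult_right_mono)
    moreover have "3 \<le> 2 * pi" using pi_ge_two by simp
    ultimately show "3 * (real n + 1) \<le> 2 * pi * sqrt (2 * real n * (real n + 1))"
      by (intro mult_mono) auto
  qed simp
  finally show ?thesis using expansion_ratio_pancake_graph(1)[of m n] m n by linarith
qed

lemma expansion_ratio_tendsto_0:
  assumes n: "n > 0"
  shows "(\<lambda>m. expansion_ratio (pancake_graph m n)) \<longlonglongrightarrow> 0"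
proof (rule tendsto_sandwich)
  let ?C = "2 * pi * sqrt (2 * real n * (real n + 1))"
  show "\<forall>\<^sub>F m in sequentially. 0 \<le> expansion_ratio (pancake_graph m n)"
    using eventually_ge_at_top[of "2::nat"]
    by eventually_elim (rule expansion_ratio_pancake_graph(2)[OF _ n])
  show "\<forall>\<^sub>F m in sequentially. expansion_ratio (pancake_graph m n) \<le> ?C / real m"
    using eventually_gt_at_top[of "2::nat"]
    by eventually_elim (rule expansion_ratio_le[OF _ n])
  show "(\<lambda>m. ?C / real m) \<longlonglongrightarrow> 0" by (rule lim_const_over_n)
qed simp

lemma regular_pancake_family:
  assumes n: "n > 0"
  shows "regular_graph_family (2 * n) (\<lambda>j. pancake_graph (j + 2) n)"
  unfolding regular_graph_family_def
proof (intro conjI allI impI)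
  fix j :: nat assume "j \<ge> 1"
  then show "finite_regular_graph (2 * n) (pancake_graph (j + 2) n)"
    by (intro finite_regular_pancake_graph) simp
next
  have "j \<le> card (verts (pancake_graph (j + 2) n))" for j
  proof -
    have "0 < n * ((j + 2) ^ (n - 1) * fact (n - 1))" using n by simp
    then have "j * 1 \<le> (j + 2) * (n * ((j + 2) ^ (n - 1) * fact (n - 1)))"
      by (intro mult_le_mono) linarith+
    also have "\<dots> = card (low_color (j + 2) n (j + 2))"
      using card_low_color[of "j + 2" "j + 2" n] by (simp only: mult.left_commute[of n])
    finally show ?thesis using verts_eq_low_color[of "j + 2" n] n by simp
  qed
  then show "filterlim (\<lambda>j. card (verts (pancake_graph (j + 2) n))) at_top sequentially"
    by (intro filterlim_at_top_mono[OF filterlim_ident]) auto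
qed

theorem mainTheorem3:
  shows "(\<forall>m n :: nat. m > 2 \<longrightarrow> n \<ge> 2 \<longrightarrow>
            expansion_ratio (pancake_graph m n) \<le> 2 * pi * sqrt (2 * real n * (real n + 1)) / real m)
       \<and> (\<forall>n::nat. n \<ge> 2 \<longrightarrow>
            ((\<lambda>m::nat. expansion_ratio (pancake_graph m n)) \<longlongrightarrow> 0) at_top)
       \<and> (\<forall>n::nat. n > 2 \<longrightarrow>
            regular_graph_family (2 * n) (\<lambda>j. pancake_graph (j + 2) n)
          \<and> \<not> expander_family (2 * n) (\<lambda>j. pancake_graph (j + 2) n))"
proof (intro conjI allI impI)
  fix m n :: nat assume "m > 2" "n \<ge> 2"
  then show "expansion_ratio (pancake_graph m n) \<le> 2 * pi * sqrt (2 * real n * (real n + 1)) / real m"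
    by (intro expansion_ratio_le) auto
next
  fix n :: nat assume "n \<ge> 2"
  then show "(\<lambda>m. expansion_ratio (pancake_graph m n)) \<longlonglongrightarrow> 0"
    by (intro expansion_ratio_tendsto_0) auto
next
  fix n :: nat assume n: "n > 2"
  then show "regular_graph_family (2 * n) (\<lambda>j. pancake_graph (j + 2) n)"
    by (intro regular_pancake_family) auto
  show "\<not> expander_family (2 * n) (\<lambda>j. pancake_graph (j + 2) n)"
  proof
    assume "expander_family (2 * n) (\<lambda>j. pancake_graph (j + 2) n)"
    then obtain \<epsilon> where \<epsilon>: "\<epsilon> > 0" "\<And>j. j \<ge> 1 \<Longrightarrow> \<epsilon> \<le> expansion_ratio (pancake_graph (j + 2) n)"
      by (auto simp: expander_family_def)
    have "(\<lambda>j. expansion_ratio (pancake_graph (j + 2) n)) \<longlonglongrightarrow> 0"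
      using n by (intro LIMSEQ_ignore_initial_segment expansion_ratio_tendsto_0) auto
    then have "\<epsilon> \<le> 0" using \<epsilon>(2) by (intro LIMSEQ_le_const) auto
    with \<epsilon>(1) show False by simp
  qed
qed

end
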